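(* Let $m\ge p\ge2$ and let $G:(\mathbb{R}^m,0)\to(\mathbb{R}^p,0)$ be a non-constant real analytic map germ with $\operatorname{Disc}G=\{0\}$. If $G$ is Thom regular at $V_G$, then $G$ satisfies the Milnor condition (b) at the origin.
   Context: A germ is identified with a representative $G:U\to\mathbb{R}^p$, $U\subseteq\mathbb{R}^m$ an open neighbourhood of $0$, $G(0)=0$. Put $V_G:=G^{-1}(0)$, $\operatorname{Sing}G:=\{x\in U:\operatorname{rank}\,dG(x)\text{ is not maximal}\}$, $\operatorname{Disc}G:=G(\operatorname{Sing}G)$; all sets are considered as germs at the origin. $B^m_\varepsilon$ is the open ball of radius $\varepsilon$ centred at $0$ in $\mathbb{R}^m$. Thom regularity when $\operatorname{Disc}G=\{0\}$ (classical sense): $G$ is Thom regular at $V_G$ if there are $\varepsilon>0$ and a stratification $\{W_\alpha\}_\alpha$ of $V_G\cap B^m_\varepsilon$ such that $\{B^m_\varepsilon\setminus V_G\}\cup\{W_\alpha\}_\alpha$ is a Whitney stratification of $B^m_\varepsilon$ and, for every $\alpha$, the pair $(B^m_\varepsilon\setminus V_G,W_\alpha)$ satisfies the Thom $(a_G)$-condition: whenever $x\in W_\alpha$ and $\{x_n\}\subset B^m_\varepsilon\setminus V_G$ is a sequence converging to $x$ such that $\ker d_{x_n}G$ converges to a linear subspace $\mathcal{T}$ in the Grassmannian, one has $T_xW_\alpha\subset\mathcal{T}$. Milnor set (with $\rho(x)=\|x\|^2$): $M(G)$ is the set of $x\in U$ at which $G$ and $\rho$ are not transverse; equivalently, the set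 of $x\in U$ at which $\nabla\rho(x),\nabla G_1(x),\dots,\nabla G_p(x)$ are linearly dependent over $\mathbb{R}$. Milnor condition (b) at the origin: $\overline{M(G)\setminus V_G}\cap V_G\subseteq\{0\}$ as germs of sets at the origin. *)

theory Defs
  imports "HOL-Analysis.Analysis" "HOL-Library.Disjoint_Sets"
begin

section \<open>Germs at the origin\<close>

definition germ_subset :: "'a::real_normed_vector set \<Rightarrow> 'a set \<Rightarrow> bool" where
  "germ_subset A B \<longleftrightarrow> (\<forall>\<^sub>F x in nhds 0. x \<in> A \<longrightarrow> x \<in> B)"

definition germ_eq :: "'a::real_normed_vector set \<Rightarrow> 'a set \<Rightarrow> bool" where
  "germ_eq A B \<longleftrightarrow> (\<forall>\<^sub>F x in nhds 0. x \<in> A \<longleftrightarrow> x \<in> B)"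

definition nonconstant_germ :: "('a::real_normed_vector \<Rightarrow> 'b) \<Rightarrow> bool" where
  "nonconstant_germ f \<longleftrightarrow> \<not> (\<exists>c. \<forall>\<^sub>F x in nhds 0. f x = c)"


section \<open>Real analytic maps\<close>

text \<open>Multi-indices are functions \<^typ>\<open>'m \<Rightarrow> nat\<close>; summability over the set of all of them
  (\<^const>\<open>has_sum\<close>) is absolute convergence of the power series.\<close>

definition real_analytic_on :: "(real^'m \<Rightarrow> real^'p) \<Rightarrow> (real^'m) set \<Rightarrow> bool" where
  "real_analytic_on f U \<longleftrightarrow>
     (\<forall>a\<in>U. \<forall>i. \<exists>r>0. \<exists>c :: ('m \<Rightarrow> nat) \<Rightarrow> real. \<forall>x\<in>ball a r.
        ((\<lambda>\<alpha>. c \<alpha> * (\<Prod>j\<in>UNIV. (x $ j - a $ j) ^ \<alpha> j)) has_sum f x $ i) UNIV)"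


section \<open>Zero locus, singular set, discriminant, Milnor set\<close>

text \<open>All of these refer to a representative \<open>G\<close> of the germ on the open set \<open>U\<close>.\<close>

definition zero_locus :: "(real^'m) set \<Rightarrow> (real^'m \<Rightarrow> real^'p) \<Rightarrow> (real^'m) set" where
  "zero_locus U G = {x\<in>U. G x = 0}"

definition sing :: "(real^'m) set \<Rightarrow> (real^'m \<Rightarrow> real^'p) \<Rightarrow> (real^'m) set" where
  "sing U G = {x\<in>U. rank (matrix (frechet_derivative G (at x))) < min CARD('m) CARD('p)}"

definition disc :: "(real^'m) set \<Rightarrow> (real^'m \<Rightarrow> real^'p) \<Rightarrow> (real^'p) set" where
  "disc U G = G ` sing U G"

text \<open>The germ at \<open>0\<close> of the image \<^term>\<open>disc U G\<close> can depend on the representative, so the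
  equality of germs is required for all sufficiently small ones.\<close>

definition disc_germ_is_origin :: "(real^'m) set \<Rightarrow> (real^'m \<Rightarrow> real^'p) \<Rightarrow> bool" where
  "disc_germ_is_origin U G \<longleftrightarrow>
     (\<forall>\<^sub>F \<epsilon> in at_right 0. germ_eq (disc (U \<inter> ball 0 \<epsilon>) G) {0})"

definition gradient :: "('a::real_inner \<Rightarrow> real) \<Rightarrow> 'a \<Rightarrow> 'a" where
  "gradient f x = (THE D. GDERIV f x :> D)"

text \<open>Linear dependence is that of the family \<open>\<nabla>\<rho>, \<nabla>G\<^sub>1, \<dots>, \<nabla>G\<^sub>p\<close>, not of the set of
  its members (\<^const>\<open>dependent\<close> would miss repeated gradients).\<close>

definition milnor_set :: "(real^'m) set \<Rightarrow> (real^'m \<Rightarrow> real^'p) \<Rightarrow> (real^'m) set" where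
  "milnor_set U G = {x\<in>U. \<exists>(a::real) (c::'p \<Rightarrow> real). (a \<noteq> 0 \<or> (\<exists>i. c i \<noteq> 0)) \<and>
      a *\<^sub>R gradient (\<lambda>y. (norm y)\<^sup>2) x + (\<Sum>i\<in>UNIV. c i *\<^sub>R gradient (\<lambda>y. G y $ i) x) = 0}"

definition milnor_condition_b :: "(real^'m) set \<Rightarrow> (real^'m \<Rightarrow> real^'p) \<Rightarrow> bool" where
  "milnor_condition_b U G \<longleftrightarrow>
     germ_subset (closure (milnor_set U G - zero_locus U G) \<inter> zero_locus U G) {0}"


section \<open>Smooth submanifolds and their tangent spaces\<close>

text \<open>Iterated directional derivatives; for open \<open>S\<close> in a Euclidean space this is the usual
  class \<open>C\<^sup>k\<close>.\<close>

primrec C_k_on :: "nat \<Rightarrow> ('a::real_normed_vector \<Rightarrow> 'b::real_normed_vector) \<Rightarrow> 'a set \<Rightarrow> bool" where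
  "C_k_on 0 f S \<longleftrightarrow> continuous_on S f"
| "C_k_on (Suc k) f S \<longleftrightarrow> (\<forall>x\<in>S. f differentiable (at x)) \<and>
     (\<forall>v. C_k_on k (\<lambda>x. frechet_derivative f (at x) v) S)"

definition C_infinity_on :: "('a::real_normed_vector \<Rightarrow> 'b::real_normed_vector) \<Rightarrow> 'a set \<Rightarrow> bool" where
  "C_infinity_on f S \<longleftrightarrow> (\<forall>k. C_k_on k f S)"

text \<open>Embedded submanifolds, not necessarily connected or closed, of one dimension \<open>d\<close>.\<close>

definition smooth_submanifold :: "'a::euclidean_space set \<Rightarrow> bool" where
  "smooth_submanifold S \<longleftrightarrow>
     (\<exists>d. \<forall>x\<in>S. \<exists>A B \<phi> \<psi>. \<exists>L::'a set.
        open A \<and> x \<in> A \<and> open B \<and> homeomorphism A B \<phi> \<psi> \<and>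
        C_infinity_on \<phi> A \<and> C_infinity_on \<psi> B \<and>
        subspace L \<and> dim L = d \<and> \<phi> ` (S \<inter> A) = L \<inter> B)"

text \<open>Velocities at \<open>x\<close> of curves in \<open>S\<close>. For a submanifold it makes no difference whether the
  curves are required to be smooth or only differentiable at the one parameter \<open>0\<close>.\<close>

definition tangent_space :: "'a::real_normed_vector set \<Rightarrow> 'a \<Rightarrow> 'a set" where
  "tangent_space S x = {v. \<exists>\<gamma>::real \<Rightarrow> 'a. \<gamma> 0 = x \<and> (\<forall>\<^sub>F t in nhds 0. \<gamma> t \<in> S) \<and>
      (\<gamma> has_vector_derivative v) (at 0)}"

text \<open>Convergence in the Grassmannian, embedded in the space of linear endomorphisms by sending a
  subspace to its orthogonal projection (here \<^const>\<open>closest_point\<close>); in finite dimension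
  operator convergence is pointwise.\<close>

definition grassmann_tendsto :: "(nat \<Rightarrow> 'a::euclidean_space set) \<Rightarrow> 'a set \<Rightarrow> bool" where
  "grassmann_tendsto T L \<longleftrightarrow>
     subspace L \<and> (\<forall>n. subspace (T n) \<and> dim (T n) = dim L) \<and>
     (\<forall>v. (\<lambda>n. closest_point (T n) v) \<longlonglongrightarrow> closest_point L v)"


section \<open>Stratifications and regularity conditions\<close>

definition stratification :: "'a::euclidean_space set \<Rightarrow> 'a set set \<Rightarrow> bool" where
  "stratification A \<S> \<longleftrightarrow>
     partition_on A \<S> \<and> (\<forall>S\<in>\<S>. smooth_submanifold S) \<and>
     (\<forall>x\<in>A. \<exists>N. open N \<and> x \<in> N \<and> finite {S\<in>\<S>. S \<inter> N \<noteq> {}})"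

definition whitney_a :: "'a::euclidean_space set \<Rightarrow> 'a set \<Rightarrow> bool" where
  "whitney_a X Y \<longleftrightarrow>
     (\<forall>x y T. (\<forall>n. x n \<in> X) \<longrightarrow> y \<in> Y \<longrightarrow> x \<longlonglongrightarrow> y \<longrightarrow>
        grassmann_tendsto (\<lambda>n. tangent_space X (x n)) T \<longrightarrow> tangent_space Y y \<subseteq> T)"

definition whitney_b :: "'a::euclidean_space set \<Rightarrow> 'a set \<Rightarrow> bool" where
  "whitney_b X Y \<longleftrightarrow>
     (\<forall>x y z T l. (\<forall>n. x n \<in> X) \<longrightarrow> (\<forall>n. y n \<in> Y) \<longrightarrow> (\<forall>n. x n \<noteq> y n) \<longrightarrow>
        z \<in> Y \<longrightarrow> x \<longlonglongrightarrow> z \<longrightarrow> y \<longlonglongrightarrow> z \<longrightarrow>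
        grassmann_tendsto (\<lambda>n. tangent_space X (x n)) T \<longrightarrow>
        grassmann_tendsto (\<lambda>n. span {x n - y n}) l \<longrightarrow> l \<subseteq> T)"

definition whitney_stratification :: "'a::euclidean_space set \<Rightarrow> 'a set set \<Rightarrow> bool" where
  "whitney_stratification A \<S> \<longleftrightarrow>
     stratification A \<S> \<and>
     (\<forall>X\<in>\<S>. \<forall>Y\<in>\<S>. X \<noteq> Y \<longrightarrow> whitney_a X Y \<and> whitney_b X Y)"

text \<open>The condition \<open>(a\<^sub>G)\<close> for the pair formed by an open set \<open>X\<close> and a submanifold \<open>W\<close>.\<close>

definition thom_condition ::
    "(real^'m \<Rightarrow> real^'p) \<Rightarrow> (real^'m) set \<Rightarrow> (real^'m) set \<Rightarrow> bool" where
  "thom_condition G X W \<longleftrightarrow>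
     (\<forall>x s T. x \<in> W \<longrightarrow> (\<forall>n. s n \<in> X) \<longrightarrow> s \<longlonglongrightarrow> x \<longrightarrow>
        grassmann_tendsto (\<lambda>n. {v. frechet_derivative G (at (s n)) v = 0}) T \<longrightarrow>
        tangent_space W x \<subseteq> T)"

definition thom_regular :: "(real^'m) set \<Rightarrow> (real^'m \<Rightarrow> real^'p) \<Rightarrow> bool" where
  "thom_regular U G \<longleftrightarrow>
     (\<exists>\<epsilon>>0. \<exists>\<W>. ball 0 \<epsilon> \<subseteq> U \<and>
        stratification (zero_locus U G \<inter> ball 0 \<epsilon>) \<W> \<and>
        whitney_stratification (ball 0 \<epsilon>) (insert (ball 0 \<epsilon> - zero_locus U G) \<W>) \<and>
        (\<forall>W\<in>\<W>. thom_condition G (ball 0 \<epsilon> - zero_locus U G) W))"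

end

theory Submission
  imports Defs
begin

text \<open>Let \<open>x \<noteq> 0\<close> be a point of \<open>V\<^sub>G\<close> near \<open>0\<close> in the closure of \<open>M(G) - V\<^sub>G\<close>, and \<open>W\<close> its stratum.
  Points \<open>x\<^sub>n \<in> M(G) - V\<^sub>G\<close> tending to \<open>x\<close> are regular because the discriminant is trivial,
  so each \<open>x\<^sub>n\<close> is orthogonal to \<open>ker d G(x\<^sub>n)\<close>. In the limit the Thom condition makes \<open>x\<close> orthogonal
  to \<open>T\<^sub>x W\<close>. This is impossible for small \<open>x\<close>, since the strata are transverse to small spheres.
  For the stratum through \<open>0\<close>, this holds because it is a \<open>C\<^sup>1\<close> submanifold. For another
  stratum \<open>W\<close> and \<open>y\<^sub>n \<rightarrow> 0\<close> in \<open>W\<close>, Whitney's condition (b) forces the limit of the lines \<open>\<real> y\<^sub>n\<close> into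
  the limit of the tangent spaces \<open>T W\<close> at \<open>y\<^sub>n\<close>; so \<open>y\<^sub>n\<close> cannot be orthogonal to all of them.\<close>


section \<open>Compactness of the Grassmannian\<close>

lemma closest_point_subspace_eqI:
  fixes S :: "'a::euclidean_space set"
  assumes "subspace S" "p \<in> S" and orth: "\<And>y. y \<in> S \<Longrightarrow> (v - p) \<bullet> y = 0"
  shows "closest_point S v = p"
proof -
  have "dist v p \<le> dist v z" if "z \<in> S" for z
  proof -
    \<comment> \<open>Since \<open>p - z\<close> lies in \<open>S\<close>, Pythagoras shows that no
      point of \<open>S\<close> is nearer to \<open>v\<close> than \<open>p\<close>.\<close>
    have "(v - p) \<bullet> (p - z) = 0"
      using assms that by (auto intro!: orth subspace_diff)
    then have "(dist v z)\<^sup>2 = (dist v p)\<^sup>2 + (dist p z)\<^sup>2"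
      unfolding dist_norm power2_norm_eq_inner by (simp add: inner_simps inner_commute)
    then show ?thesis by (simp add: power2_le_imp_le)
  qed
  then show ?thesis
    using closest_point_unique[of S p v] assms(1,2) subspace_imp_convex closed_subspace by metis
qed

lemma closest_point_subspace_in:
  fixes S :: "'a::euclidean_space set"
  shows "subspace S \<Longrightarrow> closest_point S v \<in> S"
  using closest_point_in_set closed_subspace subspace_0 by blast

lemma closest_point_subspace_orthogonal:
  fixes S :: "'a::euclidean_space set"
  assumes "subspace S" "y \<in> S"
  shows "(v - closest_point S v) \<bullet> y = 0"
proof -
  obtain p q where pq: "p \<in> span S" "\<And>w. w \<in> span S \<Longrightarrow> orthogonal q w" "v = p + q"
    using orthogonal_subspace_decomp_exists[of S v] by metis
  have [simp]: "span S = S" using assms by (simp add: span_eq_iff)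
  then have "closest_point S v = p"
    using assms pq by (intro closest_point_subspace_eqI) (auto simp: orthogonal_def)
  with pq assms show ?thesis by (auto simp: orthogonal_def)
qed

lemma closest_point_subspace_id:
  fixes S :: "'a::euclidean_space set"
  shows "subspace S \<Longrightarrow> closest_point S v = v \<longleftrightarrow> v \<in> S"
  by (metis closest_point_self closest_point_subspace_in)

lemma linear_closest_point_subspace:
  fixes S :: "'a::euclidean_space set"
  assumes "subspace S"
  shows "linear (closest_point S)"
proof (rule linearI)
  let ?p = "closest_point S"
  note mem = closest_point_subspace_in[OF assms]
  have orth: "?p x \<bullet> y = x \<bullet> y" if "y \<in> S" for x y
    using closest_point_subspace_orthogonal[OF assms that, of x] by (simp add: inner_diff_left)
  show "?p (x + y) = ?p x + ?p y" for x y
    by (intro closest_point_subspace_eqI assms subspace_add mem)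
      (simp add: inner_diff_left inner_add_left orth)
  show "?p (c *\<^sub>R x) = c *\<^sub>R ?p x" for c x
    by (intro closest_point_subspace_eqI assms subspace_scale mem)
      (simp add: inner_diff_left orth)
qed

lemma norm_closest_point_subspace_le:
  fixes S :: "'a::euclidean_space set"
  assumes "subspace S"
  shows "norm (closest_point S v) \<le> norm v"
proof -
  let ?p = "closest_point S v"
  have "?p \<bullet> ?p = v \<bullet> ?p"
    using closest_point_subspace_orthogonal[OF assms closest_point_subspace_in[OF assms], of v v]
    by (simp add: inner_simps)
  also have "\<dots> \<le> norm v * norm ?p" by (rule norm_cauchy_schwarz)
  finally have "norm ?p * norm ?p \<le> norm v * norm ?p"
    by (metis power2_norm_eq_inner power2_eq_square)
  then show ?thesis
    by (metis mult_right_le_imp_le norm_ge_zero order_le_less)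
qed

text \<open>If the projection onto \<open>T\<close> killed a nonzero vector of \<open>S\<close>, the
  two projections of this vector would differ by its full norm. So the projection onto
  \<open>T\<close> is injective on \<open>S\<close>.\<close>

lemma dim_le_if_projections_close:
  fixes S T :: "'a::euclidean_space set"
  assumes "subspace S" "subspace T"
    and close: "\<And>v. v \<noteq> 0 \<Longrightarrow> norm (closest_point S v - closest_point T v) < norm v"
  shows "dim S \<le> dim T"
proof -
  have lin: "linear (closest_point T)"
    using linear_closest_point_subspace assms by blast
  have "v = 0" if "v \<in> S" "closest_point T v = 0" for v
    using close[of v] that by (auto simp: closest_point_self)
  then have "inj_on (closest_point T) (span S)"
    unfolding span_eq_iff[THEN iffD2, OF assms(1)]
    using lin assms(1) by (simp add: linear_injective_on_subspace_0)
  then have "dim S = dim (closest_point T ` S)"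
    using lin by (metis dim_image_eq)
  also have "\<dots> \<le> dim T"
    using closest_point_subspace_in assms by (intro dim_subset) auto
  finally show ?thesis .
qed

section \<open>Limits of subspaces\<close>

lemma grassmann_tendsto_subseq:
  assumes "grassmann_tendsto T L" "strict_mono r"
  shows "grassmann_tendsto (T \<circ> r) L"
  using assms LIMSEQ_subseq_LIMSEQ[OF _ assms(2)]
  unfolding grassmann_tendsto_def by (fastforce simp: comp_def)

text \<open>The dimension need not be assumed constant: orthogonal projections at distance less than 1
  have the same rank, so it is eventually constant along the subsequence.\<close>

lemma grassmann_compact:
  fixes T :: "nat \<Rightarrow> 'a::euclidean_space set"
  assumes sub: "\<And>n. subspace (T n)"
  obtains L r where "strict_mono r" "grassmann_tendsto (T \<circ> r) L"
proof -
  \<comment> \<open>As bounded operators the projections lie in the unit ball of a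
    finite-dimensional space, so a subsequence converges in norm.\<close>
  define P where "P n = Blinfun (closest_point (T n))" for n
  have P: "blinfun_apply (P n) = closest_point (T n)" for n
    using linear_closest_point_subspace[OF sub]
    by (simp add: P_def bounded_linear_Blinfun_apply linear_conv_bounded_linear)
  have "norm (P n) \<le> 1" for n
    using norm_closest_point_subspace_le[OF sub] by (intro norm_blinfun_bound) (auto simp: P)
  then have "bounded (range P)"
    unfolding bounded_iff by blast
  then obtain Q r where r: "strict_mono r" and lim: "(P \<circ> r) \<longlonglongrightarrow> Q"
    using bounded_imp_convergent_subsequence by blast
  define R where "R n = P (r n)" for n
  have R: "R \<longlonglongrightarrow> Q" using lim unfolding R_def comp_def .
  have app: "blinfun_apply (R n) = closest_point (T (r n))" for n by (simp add: R_def P)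
  have lim1: "(\<lambda>n. R n v) \<longlonglongrightarrow> Q v" for v
    using R by (intro tendsto_intros)
  \<comment> \<open>This orthogonality relation characterises orthogonal projections among linear
    maps and survives limits; hence \<open>Q\<close> is the projection onto its range.\<close>
  have "(\<lambda>n. (v - R n v) \<bullet> R n w) \<longlonglongrightarrow> (v - Q v) \<bullet> Q w" for v w
    by (intro tendsto_intros lim1)
  moreover have "(v - R n v) \<bullet> R n w = 0" for n v w
    by (simp add: app closest_point_subspace_in closest_point_subspace_orthogonal sub)
  ultimately have orth: "(v - Q v) \<bullet> Q w = 0" for v w
    using LIMSEQ_unique tendsto_const by fastforce
  define L where "L = range Q"
  have "linear Q"
    using blinfun.bounded_linear_right bounded_linear.linear by blast
  then have L: "subspace L"
    unfolding L_def using linear_subspace_image subspace_UNIV by blast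
  have cpL: "closest_point L v = Q v" for v
    using L by (intro closest_point_subspace_eqI) (auto simp: L_def orth)
  have "\<forall>\<^sub>F n in sequentially. dist (R n) Q < 1"
    using R tendstoD zero_less_one by blast
  then obtain N where N: "norm (R n - Q) < 1" if "n \<ge> N" for n
    unfolding eventually_sequentially dist_norm by blast
  have "dim (T (r n)) = dim L" if "n \<ge> N" for n
  proof -
    have "norm (closest_point (T (r n)) v - closest_point L v) < norm v" if "v \<noteq> 0" for v
    proof -
      have "norm ((R n - Q) v) \<le> norm (R n - Q) * norm v" by (rule norm_blinfun)
      also have "\<dots> < norm v" using N[OF \<open>n \<ge> N\<close>] that by simp
      finally show ?thesis by (simp add: app cpL blinfun.diff_left)
    qed
    then show ?thesis
      using dim_le_if_projections_close[OF sub L, of "r n"] dim_le_if_projections_close[OF L sub, of "r n"]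
      by (simp add: norm_minus_commute)
  qed
  moreover have "(\<lambda>n. closest_point (T (r (n + N))) v) \<longlonglongrightarrow> closest_point L v" for v
    using LIMSEQ_ignore_initial_segment[OF lim1[of v], of N] by (simp add: app cpL)
  \<comment> \<open>\<open>grassmann_tendsto\<close> asks for the dimension of the limit at every
    index, so the first \<open>N\<close> terms are dropped.\<close>
  ultimately have "grassmann_tendsto (T \<circ> (\<lambda>n. r (n + N))) L"
    unfolding grassmann_tendsto_def using L sub by simp
  moreover have "strict_mono (\<lambda>n. r (n + N))"
    using r by (simp add: strict_mono_def)
  ultimately show ?thesis using that by blast
qed


section \<open>Tangent spaces of submanifolds\<close>

lemma has_derivative_frechet_derivative:
  "f differentiable (at x) \<Longrightarrow> (f has_derivative frechet_derivative f (at x)) (at x)"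
  by (simp add: frechet_derivative_works)

lemma C_infinity_on_differentiable:
  "C_infinity_on f S \<Longrightarrow> x \<in> S \<Longrightarrow> f differentiable (at x)"
  unfolding C_infinity_on_def by (metis C_k_on.simps(2))

lemma C_infinity_on_continuous_derivative:
  assumes "C_infinity_on f S"
  shows "continuous_on S (\<lambda>x. frechet_derivative f (at x) v)"
proof -
  have "C_k_on (Suc 0) f S" using assms by (simp add: C_infinity_on_def)
  then show ?thesis by simp
qed

text \<open>The required curve is the image under \<psi> of the straight line through
  \<open>\<phi> x\<close> in direction \<open>l\<close>, which stays in \<open>L\<close> and, for
  small parameters, in \<open>B\<close>.\<close>

lemma tangent_vector_via_chart:
  fixes S :: "'a::euclidean_space set" and L :: "'b::euclidean_space set"
  assumes "homeomorphism A B \<phi> \<psi>" "open B" "x \<in> S" "x \<in> A"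
    and \<psi>: "\<psi> differentiable (at (\<phi> x))"
    and L: "subspace L" "\<phi> ` (S \<inter> A) = L \<inter> B" and l: "l \<in> L"
  shows "frechet_derivative \<psi> (at (\<phi> x)) l \<in> tangent_space S x"
proof -
  define \<gamma> where "\<gamma> t = \<psi> (\<phi> x + t *\<^sub>R l)" for t :: real
  have hom: "\<phi> x \<in> B" "\<psi> (\<phi> x) = x" "\<And>y. y \<in> S \<inter> A \<Longrightarrow> \<psi> (\<phi> y) = y"
    using assms(1,4) by (auto simp: homeomorphism_def)
  have "((\<lambda>t. \<phi> x + t *\<^sub>R l) \<longlongrightarrow> \<phi> x + 0 *\<^sub>R l) (nhds 0)"
    by (intro tendsto_intros) (simp add: filterlim_ident)
  then have "\<forall>\<^sub>F t in nhds 0. \<phi> x + t *\<^sub>R l \<in> B"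
    using \<open>open B\<close> hom(1) by (auto dest: topological_tendstoD)
  then have ev: "\<forall>\<^sub>F t in nhds 0. \<gamma> t \<in> S"
  proof eventually_elim
    case (elim t)
    have "\<phi> x \<in> L" using L assms(3,4) by blast
    then have "\<phi> x + t *\<^sub>R l \<in> L" using L(1) l by (intro subspace_add subspace_scale)
    then obtain y where "y \<in> S \<inter> A" "\<phi> x + t *\<^sub>R l = \<phi> y"
      using elim L(2) by (metis IntI imageE)
    then show ?case using hom(3) by (simp add: \<gamma>_def)
  qed
  have "(\<psi> has_derivative frechet_derivative \<psi> (at (\<phi> x))) (at (\<phi> x + 0 *\<^sub>R l))"
    using has_derivative_frechet_derivative[OF \<psi>] by simp
  moreover have "((\<lambda>t. \<phi> x + t *\<^sub>R l) has_derivative (\<lambda>t. t *\<^sub>R l)) (at 0)"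
    by (auto intro!: derivative_eq_intros)
  ultimately have "(\<gamma> has_derivative (\<lambda>t. frechet_derivative \<psi> (at (\<phi> x)) (t *\<^sub>R l))) (at 0)"
    unfolding \<gamma>_def by (rule has_derivative_compose[rotated])
  then have "(\<gamma> has_vector_derivative frechet_derivative \<psi> (at (\<phi> x)) l) (at 0)"
    by (simp add: has_vector_derivative_def linear_scale[OF linear_frechet_derivative[OF \<psi>]])
  then show ?thesis
    using ev hom(2) unfolding tangent_space_def by (intro CollectI exI[of _ \<gamma>]) (simp add: \<gamma>_def)
qed

lemma tangent_space_via_chart:
  fixes S :: "'a::euclidean_space set" and L :: "'b::euclidean_space set"
  assumes hom: "homeomorphism A B \<phi> \<psi>" and "open A" "open B" "x \<in> S" "x \<in> A"
    and \<phi>: "\<phi> differentiable (at x)" and \<psi>: "\<psi> differentiable (at (\<phi> x))"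
    and L: "subspace L" "\<phi> ` (S \<inter> A) = L \<inter> B"
  shows "tangent_space S x = frechet_derivative \<psi> (at (\<phi> x)) ` L"
proof -
  let ?D = "frechet_derivative \<phi> (at x)" and ?E = "frechet_derivative \<psi> (at (\<phi> x))"
  have px: "\<phi> x \<in> B" "\<psi> (\<phi> x) = x" "\<phi> x \<in> L"
    using hom assms(4,5) L by (auto simp: homeomorphism_def)
  have ED: "?E (?D v) = v" for v
  proof -
    have "((\<lambda>y. \<psi> (\<phi> y)) has_derivative (\<lambda>v. ?E (?D v))) (at x)"
      by (rule has_derivative_compose[OF has_derivative_frechet_derivative[OF \<phi>]
            has_derivative_frechet_derivative[OF \<psi>]])
    then have "((\<lambda>y. y) has_derivative (\<lambda>v. ?E (?D v))) (at x)"
      by (rule has_derivative_transform_within_open[OF _ \<open>open A\<close> \<open>x \<in> A\<close>])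
        (use hom in \<open>auto simp: homeomorphism_def\<close>)
    then show ?thesis
      using has_derivative_unique[OF _ has_derivative_ident] by metis
  qed
  have "v \<in> ?E ` L" if v: "v \<in> tangent_space S x" for v
  proof -
    obtain \<gamma> :: "real \<Rightarrow> 'a"
      where \<gamma>: "\<gamma> 0 = x" "\<forall>\<^sub>F t in nhds 0. \<gamma> t \<in> S" "(\<gamma> has_vector_derivative v) (at 0)"
      using v unfolding tangent_space_def by blast
    have "isCont \<gamma> 0" using \<gamma>(3) has_vector_derivative_continuous by blast
    then have "(\<gamma> \<longlongrightarrow> x) (nhds 0)"
      using \<gamma>(1) by (metis isContD tendsto_at_iff_tendsto_nhds)
    then have "\<forall>\<^sub>F t in nhds 0. \<gamma> t \<in> A"
      using assms(2,5) by (rule topological_tendstoD)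
    with \<gamma>(2) have "\<forall>\<^sub>F t in nhds 0. \<phi> (\<gamma> t) \<in> L"
      by eventually_elim (use L(2) in blast)
    \<comment> \<open>The curve \<open>\<phi> (\<gamma> t)\<close> runs in \<open>L\<close>, so
      projecting it onto \<open>L\<close> changes nothing near 0. Comparing the derivatives of both
      forms puts \<open>?D v\<close> into \<open>L\<close>.\<close>
    then have ev: "\<forall>\<^sub>F t in nhds 0. closest_point L (\<phi> (\<gamma> t)) = \<phi> (\<gamma> t)"
      by eventually_elim (simp add: closest_point_self)
    have "(\<phi> has_derivative ?D) (at (\<gamma> 0))"
      using has_derivative_frechet_derivative[OF \<phi>] \<gamma>(1) by simp
    then have der: "((\<lambda>t. \<phi> (\<gamma> t)) has_derivative (\<lambda>t. ?D (t *\<^sub>R v))) (at 0)"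
      using \<gamma>(3) unfolding has_vector_derivative_def by (rule has_derivative_compose[rotated])
    have "((\<lambda>t. closest_point L (\<phi> (\<gamma> t))) has_derivative (\<lambda>t. closest_point L (?D (t *\<^sub>R v)))) (at 0)"
      using linear_closest_point_subspace[OF L(1)] der
      unfolding linear_conv_bounded_linear by (rule bounded_linear.has_derivative)
    then have "((\<lambda>t. \<phi> (\<gamma> t)) has_derivative (\<lambda>t. closest_point L (?D (t *\<^sub>R v)))) (at 0)"
      by (rule has_derivative_transform_eventually)
        (use ev in \<open>auto simp: eventually_nhds_conv_at\<close>)
    with der have "?D (1 *\<^sub>R v) = closest_point L (?D (1 *\<^sub>R v))"
      using has_derivative_unique by metis
    then have "?D v \<in> L"
      by (metis closest_point_subspace_id[OF L(1)] scaleR_one)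
    then show ?thesis using ED by (metis imageI)
  qed
  then show ?thesis
    using tangent_vector_via_chart[OF hom \<open>open B\<close> \<open>x \<in> S\<close> \<open>x \<in> A\<close> \<psi> L] by blast
qed

text \<open>Velocities of curves do not visibly add up to velocities of curves; a chart exhibits
  them as a linear image of \<open>L\<close>. Compactness of the Grassmannian then applies to
  tangent spaces.\<close>

lemma subspace_tangent_space:
  fixes S :: "'a::euclidean_space set"
  assumes "smooth_submanifold S" "x \<in> S"
  shows "subspace (tangent_space S x)"
proof -
  obtain A B \<phi> \<psi> and L :: "'a set" where c: "open A" "x \<in> A" "open B" "homeomorphism A B \<phi> \<psi>"
      "C_infinity_on \<phi> A" "C_infinity_on \<psi> B"
      "subspace L" "\<phi> ` (S \<inter> A) = L \<inter> B"
    using assms unfolding smooth_submanifold_def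
    by (elim exE) (drule bspec, assumption, elim exE conjE, rule that)
  have "\<phi> x \<in> B" using c(2,4) by (auto simp: homeomorphism_def)
  then have D: "\<phi> differentiable (at x)" "\<psi> differentiable (at (\<phi> x))"
    using c C_infinity_on_differentiable by blast+
  show ?thesis
    unfolding tangent_space_via_chart[OF c(4,1,3) assms(2) c(2) D c(7,8)]
    using linear_frechet_derivative[OF D(2)] c(7) by (rule linear_subspace_image)
qed


section \<open>Transversality to small spheres\<close>

text \<open>The derivative is taken at the moving point \<open>w\<close>, because tangent vectors at
  a point near the centre come from the derivative of the chart there. Differentiability at
  \<open>z\<close> bounds the remainder taken with \<open>?D z\<close>, and continuity of the
  derivative bounds the change from \<open>?D z\<close> to \<open>?D w\<close>.\<close>

lemma C_infinity_strict_derivative: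
  fixes f :: "'a::euclidean_space \<Rightarrow> 'b::real_normed_vector"
  assumes f: "C_infinity_on f B" and "open B" "z \<in> B" and "e > 0"
  shows "\<forall>\<^sub>F w in nhds z. norm (f w - f z - frechet_derivative f (at w) (w - z)) \<le> e * norm (w - z)"
proof -
  let ?D = "\<lambda>w. frechet_derivative f (at w)"
  \<comment> \<open>The error of the derivative is summed over the basis vectors; the division by
    the dimension makes the total \<open>e / 2\<close>.\<close>
  define e' where "e' = e / (2 * DIM('a))"
  have e': "e' > 0" using \<open>e > 0\<close> by (simp add: e'_def)
  have diff: "f differentiable (at w)" if "w \<in> B" for w
    using f that by (rule C_infinity_on_differentiable)
  have "\<forall>\<^sub>F w in nhds z. \<forall>b\<in>Basis. norm (?D w b - ?D z b) < e'"
  proof (intro eventually_ball_finite finite_Basis ballI)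
    fix b :: 'a
    have "isCont (\<lambda>w. ?D w b) z"
      using C_infinity_on_continuous_derivative[OF f, of b] assms(2,3)
      by (simp add: continuous_on_eq_continuous_at)
    then have "((\<lambda>w. ?D w b) \<longlongrightarrow> ?D z b) (nhds z)"
      using tendsto_at_iff_tendsto_nhds[of "\<lambda>w. ?D w b" z] by (simp add: isCont_def)
    from tendstoD[OF this e'] show "\<forall>\<^sub>F w in nhds z. norm (?D w b - ?D z b) < e'"
      by (simp add: dist_norm)
  qed
  moreover have "\<forall>\<^sub>F w in nhds z. norm (f w - f z - ?D z (w - z)) \<le> e / 2 * norm (w - z)"
  proof -
    have "(f has_derivative ?D z) (at z)"
      by (rule has_derivative_frechet_derivative[OF diff[OF assms(3)]])
    then obtain d where "d > 0"
      "\<And>w. norm (w - z) < d \<Longrightarrow> norm (f w - f z - ?D z (w - z)) \<le> e / 2 * norm (w - z)"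
      using \<open>e > 0\<close> unfolding has_derivative_at_alt by (metis half_gt_zero)
    then show ?thesis unfolding eventually_nhds_metric dist_norm by blast
  qed
  moreover have "\<forall>\<^sub>F w in nhds z. w \<in> B"
    using assms(2,3) by (rule eventually_nhds_in_open)
  ultimately show ?thesis
  proof eventually_elim
    case (elim w)
    let ?h = "w - z"
    have lin: "linear (\<lambda>h. ?D w h - ?D z h)"
      using diff elim(3) assms(3) by (intro linear_compose_sub linear_frechet_derivative) auto
    have "?D w (\<Sum>b\<in>Basis. (?h \<bullet> b) *\<^sub>R b) - ?D z (\<Sum>b\<in>Basis. (?h \<bullet> b) *\<^sub>R b)
        = (\<Sum>b\<in>Basis. (?h \<bullet> b) *\<^sub>R (?D w b - ?D z b))"
      by (simp only: linear_sum[OF lin] linear_scale[OF lin])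
    then have "norm (?D w ?h - ?D z ?h) = norm (\<Sum>b\<in>Basis. (?h \<bullet> b) *\<^sub>R (?D w b - ?D z b))"
      by (simp only: euclidean_representation)
    also have "\<dots> \<le> (\<Sum>b\<in>(Basis :: 'a set). norm ?h * e')"
    proof (rule sum_norm_le)
      fix b :: 'a assume b: "b \<in> Basis"
      have "\<bar>?h \<bullet> b\<bar> \<le> norm ?h" using b by (rule Basis_le_norm)
      moreover have "norm (?D w b - ?D z b) \<le> e'" using elim(1) b by (auto intro: less_imp_le)
      ultimately show "norm ((?h \<bullet> b) *\<^sub>R (?D w b - ?D z b)) \<le> norm ?h * e'"
        by (simp add: mult_mono)
    qed
    also have "\<dots> = e / 2 * norm ?h" by (simp add: e'_def)
    finally have "norm (?D w ?h - ?D z ?h) \<le> e / 2 * norm ?h" .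
    moreover have "f w - f z - ?D w ?h = (f w - f z - ?D z ?h) - (?D w ?h - ?D z ?h)" by simp
    then have "norm (f w - f z - ?D w ?h)
        \<le> norm (f w - f z - ?D z ?h) + norm (?D w ?h - ?D z ?h)"
      by (metis norm_triangle_ineq4)
    ultimately show ?case using elim(2) by (simp add: field_simps)
  qed
qed

text \<open>In a chart \<open>\<phi>\<close> with inverse \<open>\<psi>\<close>, the vector \<open>d\<psi>(\<phi> y)(\<phi> y - \<phi> c)\<close> is tangent to \<open>W\<close> at \<open>y\<close> and
  differs from the radial vector \<open>y - c\<close> by at most half the norm of the latter.\<close>

lemma submanifold_transverse_to_spheres:
  fixes W :: "'a::euclidean_space set"
  assumes "smooth_submanifold W" "c \<in> W"
  shows "\<forall>\<^sub>F y in at c. y \<in> W \<longrightarrow> (\<exists>v\<in>tangent_space W y. v \<bullet> (y - c) \<noteq> 0)"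
proof -
  obtain A B \<phi> \<psi> and L :: "'a set" where *: "open A" "c \<in> A" "open B" "homeomorphism A B \<phi> \<psi>"
      "C_infinity_on \<phi> A" "C_infinity_on \<psi> B" "subspace L" "\<phi> ` (W \<inter> A) = L \<inter> B"
    using assms unfolding smooth_submanifold_def by (elim exE) (drule bspec, assumption, elim exE conjE, rule that)
  have hom: "\<And>y. y \<in> A \<Longrightarrow> \<phi> y \<in> B \<and> \<psi> (\<phi> y) = y"
    using *(4) by (auto simp: homeomorphism_def)
  have pc: "(\<phi> has_derivative frechet_derivative \<phi> (at c)) (at c)"
    using * C_infinity_on_differentiable has_derivative_frechet_derivative by blast
  then have "isCont \<phi> c" by (rule has_derivative_continuous)
  then have lim: "(\<phi> \<longlongrightarrow> \<phi> c) (nhds c)"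
    by (simp add: isCont_def flip: tendsto_at_iff_tendsto_nhds)
  obtain K where K: "\<And>v. norm (frechet_derivative \<phi> (at c) v) \<le> norm v * K" "K > 0"
    using bounded_linear.pos_bounded[OF has_derivative_bounded_linear[OF pc]] by blast
  obtain d where "d > 0"
      "\<And>y. norm (y - c) < d \<Longrightarrow> norm (\<phi> y - \<phi> c - frechet_derivative \<phi> (at c) (y - c)) \<le> 1 * norm (y - c)"
    using pc unfolding has_derivative_at_alt by (metis zero_less_one)
  then have ev1: "\<forall>\<^sub>F y in nhds c. norm (\<phi> y - \<phi> c - frechet_derivative \<phi> (at c) (y - c)) \<le> norm (y - c)"
    unfolding eventually_nhds_metric dist_norm by auto
  \<comment> \<open>Near \<open>c\<close> the map \<phi> stretches distances from \<open>c\<close>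
    by at most \<open>K + 1\<close>; this \<open>e\<close> turns the remainder of \<psi> into at
    most half of \<open>norm (y - c)\<close>.\<close>
  define e where "e = 1 / (2 * (K + 1))"
  have e: "e > 0" "e * (K + 1) = 1 / 2" using K(2) by (auto simp: e_def field_simps)
  have "\<forall>\<^sub>F w in nhds (\<phi> c). norm (\<psi> w - \<psi> (\<phi> c) - frechet_derivative \<psi> (at w) (w - \<phi> c)) \<le> e * norm (w - \<phi> c)"
    using *(2,3,6) hom e by (intro C_infinity_strict_derivative[where B = B]) auto
  then have ev2: "\<forall>\<^sub>F y in nhds c. norm (\<psi> (\<phi> y) - \<psi> (\<phi> c) - frechet_derivative \<psi> (at (\<phi> y)) (\<phi> y - \<phi> c))
      \<le> e * norm (\<phi> y - \<phi> c)"
    using lim by (auto simp: filterlim_iff)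
  have "\<forall>\<^sub>F y in nhds c. y \<in> A" using *(1,2) by (rule eventually_nhds_in_open)
  with ev1 ev2 show ?thesis
    unfolding eventually_at_filter
  proof eventually_elim
    case (elim y)
    show ?case
    proof (intro impI)
      assume "y \<noteq> c" and y: "y \<in> W"
      show "\<exists>v\<in>tangent_space W y. v \<bullet> (y - c) \<noteq> 0"
      proof (rule ccontr)
        assume "\<not> (\<exists>v\<in>tangent_space W y. v \<bullet> (y - c) \<noteq> 0)"
        then have orth: "\<forall>v\<in>tangent_space W y. v \<bullet> (y - c) = 0" by blast
        let ?w = "frechet_derivative \<psi> (at (\<phi> y)) (\<phi> y - \<phi> c)"
        have "\<phi> y - \<phi> c \<in> L"
          using *(2,7,8) y elim(3) assms(2) by (intro subspace_diff) auto
        then have "?w \<in> tangent_space W y"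
          using *(3,4,7,8) y elim(3) hom C_infinity_on_differentiable[OF *(6)]
          by (intro tangent_vector_via_chart[where A = A and B = B and L = L]) auto
        \<comment> \<open>If the radial vector were orthogonal to the tangent vector
          \<open>?w\<close>, its distance from \<open>?w\<close> would be at least its own norm,
          against the bound by half of it.\<close>
        then have "(y - c) \<bullet> (y - c) = (y - c - ?w) \<bullet> (y - c)"
          using orth by (simp add: inner_diff_left)
        also have "\<dots> \<le> norm (y - c - ?w) * norm (y - c)" by (rule norm_cauchy_schwarz)
        finally have 1: "norm (y - c) * norm (y - c) \<le> norm (y - c - ?w) * norm (y - c)"
          by (metis power2_norm_eq_inner power2_eq_square)
        have "norm (\<phi> y - \<phi> c) \<le> norm (y - c) * K + norm (y - c)"
          using norm_triangle_sub[of "\<phi> y - \<phi> c" "frechet_derivative \<phi> (at c) (y - c)"] K(1)[of "y - c"] elim(1)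
          by linarith
        then have "e * norm (\<phi> y - \<phi> c) \<le> e * (norm (y - c) * K + norm (y - c))"
          using e(1) by simp
        also have "\<dots> = e * (K + 1) * norm (y - c)" by (simp add: algebra_simps)
        finally have "e * norm (\<phi> y - \<phi> c) \<le> norm (y - c) / 2" using e(2) by simp
        with elim(2) hom[OF elim(3)] hom[OF *(2)] have 2: "norm (y - c - ?w) \<le> norm (y - c) / 2"
          by simp
        have "norm (y - c) > 0" using \<open>y \<noteq> c\<close> by simp
        with 1 have "norm (y - c) \<le> norm (y - c - ?w)" by (rule mult_right_le_imp_le)
        with 2 \<open>norm (y - c) > 0\<close> show False by simp
      qed
    qed
  qed
qed

text \<open>Meant for a stratum \<open>X\<close> that accumulates at a point \<open>c\<close> of
  another stratum \<open>Y\<close>, where no chart of \<open>X\<close> around \<open>c\<close> is at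
  hand.\<close>

lemma whitney_b_transverse_to_spheres:
  fixes X :: "'a::euclidean_space set"
  assumes X: "smooth_submanifold X" and b: "whitney_b X Y" and c: "c \<in> Y"
  shows "\<forall>\<^sub>F y in at c. y \<in> X \<longrightarrow> (\<exists>v\<in>tangent_space X y. v \<bullet> (y - c) \<noteq> 0)"
proof (rule ccontr)
  let ?S = "{y\<in>X. \<forall>v\<in>tangent_space X y. v \<bullet> (y - c) = 0}"
  assume contr: "\<not> ?thesis"
  have "c islimpt ?S"
    unfolding islimpt_iff_eventually
  proof
    assume "\<forall>\<^sub>F y in at c. y \<notin> ?S"
    with contr show False by (elim notE, elim eventually_mono) blast
  qed
  then obtain x where x: "\<And>n. x n \<in> ?S - {c}" "x \<longlonglongrightarrow> c"
    unfolding islimpt_sequential by blast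
  obtain T r where r: "strict_mono r" and T: "grassmann_tendsto ((\<lambda>n. tangent_space X (x n)) \<circ> r) T"
  proof (rule grassmann_compact)
    show "subspace (tangent_space X (x n))" for n
      using x(1)[of n] by (intro subspace_tangent_space[OF X]) simp
  qed
  \<comment> \<open>A second extraction makes the radial lines converge as well; the tangent spaces
    keep their limit along it.\<close>
  obtain l q where q: "strict_mono q" and l: "grassmann_tendsto ((\<lambda>n. span {x (r n) - c}) \<circ> q) l"
    using subspace_span by (rule grassmann_compact)
  define z where "z = (\<lambda>n. x (r (q n)))"
  have z: "z n \<in> X" "z n \<noteq> c" "v \<in> tangent_space X (z n) \<Longrightarrow> v \<bullet> (z n - c) = 0" for n v
    using x(1) by (auto simp: z_def)
  have lim: "z \<longlonglongrightarrow> c"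
    using LIMSEQ_subseq_LIMSEQ[OF LIMSEQ_subseq_LIMSEQ[OF x(2) r] q] by (simp add: z_def comp_def)
  have T: "grassmann_tendsto (\<lambda>n. tangent_space X (z n)) T"
    using grassmann_tendsto_subseq[OF T q] by (simp add: z_def comp_def)
  have l: "grassmann_tendsto (\<lambda>n. span {z n - c}) l"
    using l by (simp add: z_def comp_def)
  \<comment> \<open>With the constant sequence \<open>c\<close> as the points of \<open>Y\<close>,
    the secants in Whitney's condition are the radial lines.\<close>
  have "l \<subseteq> T"
    using b[unfolded whitney_b_def, rule_format, of z "\<lambda>_. c" c T l] z(1,2) c lim T l by simp
  \<comment> \<open>Orthogonality of the radial lines to the tangent spaces passes to the limits, so
    \<open>l\<close> is orthogonal to \<open>T\<close> while contained in it. That leaves only 0,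
    although \<open>l\<close> is a limit of lines.\<close>
  have "v = 0" if "v \<in> l" for v
  proof -
    have sub: "subspace (tangent_space X (z n))" for n
      using z(1) subspace_tangent_space[OF X] by blast
    have "(\<lambda>n. closest_point (tangent_space X (z n)) v \<bullet> closest_point (span {z n - c}) v)
        \<longlonglongrightarrow> closest_point T v \<bullet> closest_point l v"
      using T l unfolding grassmann_tendsto_def by (intro tendsto_intros) auto
    moreover have "closest_point (tangent_space X (z n)) v \<bullet> closest_point (span {z n - c}) v = 0" for n
    proof -
      have "closest_point (span {z n - c}) v \<in> span {z n - c}"
        by (rule closest_point_subspace_in) simp
      then show ?thesis
        using z(3)[OF closest_point_subspace_in[OF sub]] by (auto simp: span_singleton)
    qed
    ultimately have "closest_point T v \<bullet> closest_point l v = 0"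
      by (simp add: LIMSEQ_const_iff)
    then show ?thesis
      using \<open>l \<subseteq> T\<close> that by (auto simp: closest_point_self)
  qed
  then have "l \<subseteq> {0}" by auto
  then have "dim l = 0" by simp
  moreover have "dim l = dim (span {z 0 - c})"
    using l unfolding grassmann_tendsto_def by metis
  ultimately show False
    using z(2)[of 0] by (simp add: dim_singleton)
qed


section \<open>Milnor sets and the Thom condition\<close>

lemma gradient_eqI:
  assumes "GDERIV f x :> D"
  shows "gradient f x = D"
  unfolding gradient_def
proof (rule the_equality)
  show "GDERIV f x :> D" by (rule assms)
  fix E assume "GDERIV f x :> E"
  then have "(\<lambda>h. h \<bullet> E) = (\<lambda>h. h \<bullet> D)"
    using assms unfolding gderiv_def by (rule has_derivative_unique)
  then have "\<forall>h. h \<bullet> E = h \<bullet> D" by (blast dest: fun_cong)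
  then show "E = D" by (rule vector_eq_ldot[THEN iffD1])
qed

lemma gradient_norm_squared: "gradient (\<lambda>y. (norm y)\<^sup>2) x = 2 *\<^sub>R x"
proof (rule gradient_eqI)
  show "GDERIV (\<lambda>y. (norm y)\<^sup>2) x :> 2 *\<^sub>R x"
    unfolding gderiv_def power2_norm_eq_inner
    using has_derivative_inner[OF has_derivative_ident has_derivative_ident, of x UNIV]
    by (simp add: inner_commute mult_2_right)
qed

lemma inner_gradient_component:
  fixes G :: "real^'m \<Rightarrow> real^'p"
  assumes "G differentiable (at x)"
  shows "gradient (\<lambda>y. G y $ i) x \<bullet> v = frechet_derivative G (at x) v $ i"
proof -
  let ?D = "\<lambda>v. frechet_derivative G (at x) v $ i"
  have der: "((\<lambda>y. G y $ i) has_derivative ?D) (at x)"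
    using has_derivative_frechet_derivative[OF assms]
    by (rule bounded_linear.has_derivative[OF bounded_linear_vec_nth])
  \<comment> \<open>The adjoint at 1 is the Riesz vector of the functional \<open>?D\<close>, which
    gives the existence of the gradient.\<close>
  have eq: "h \<bullet> adjoint ?D 1 = ?D h" for h
    using adjoint_works[OF has_derivative_linear[OF der], of h 1]
    by (simp only: inner_real_def mult_1_right)
  have "GDERIV (\<lambda>y. G y $ i) x :> adjoint ?D 1"
    unfolding gderiv_def eq by (rule der)
  then show ?thesis
    by (simp only: gradient_eqI inner_commute[of _ v] eq)
qed

text \<open>Pairing the dependence relation with a kernel vector \<open>v\<close> kills the
  gradients of the components and leaves \<open>2 * a * (x \<bullet> v) = 0\<close>; at a regular
  point the coefficient \<open>a\<close> cannot vanish.\<close>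

lemma milnor_set_orthogonal_kernel:
  fixes G :: "real^'m \<Rightarrow> real^'p"
  assumes G: "G differentiable (at x)" and "CARD('p) \<le> CARD('m)"
    and x: "x \<in> milnor_set U G" "x \<notin> sing U G"
    and v: "frechet_derivative G (at x) v = 0"
  shows "x \<bullet> v = 0"
proof -
  let ?D = "frechet_derivative G (at x)"
  have lin: "linear ?D" using G by (rule linear_frechet_derivative)
  obtain a :: real and c :: "'p \<Rightarrow> real" where ac: "a \<noteq> 0 \<or> (\<exists>i. c i \<noteq> 0)"
    and dep: "a *\<^sub>R gradient (\<lambda>y. (norm y)\<^sup>2) x + (\<Sum>i\<in>UNIV. c i *\<^sub>R gradient (\<lambda>y. G y $ i) x) = 0"
    using x(1) unfolding milnor_set_def by blast
  have eq: "2 * a * (x \<bullet> w) + (\<Sum>i\<in>UNIV. c i * ?D w $ i) = 0" for w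
    using arg_cong[OF dep, of "\<lambda>u. u \<bullet> w"]
    by (simp add: inner_add_left inner_sum_left gradient_norm_squared inner_gradient_component[OF G] mult.commute mult.left_commute)
  have "a \<noteq> 0"
  proof
    assume "a = 0"
    have "rank (matrix ?D) = CARD('p)"
      using x rank_bound[of "matrix ?D"] assms(2) by (auto simp: sing_def milnor_set_def)
    then have "surj ?D"
      using full_rank_surjective[of "matrix ?D"] matrix_vector_mul(2)[OF lin] by simp
    \<comment> \<open>Choosing \<open>w\<close> with image the coefficient vector turns the relation
      into a vanishing sum of squares.\<close>
    then obtain w where "?D w = (\<chi> i. c i)" by (metis surjD)
    with eq[of w] \<open>a = 0\<close> have "(\<Sum>i\<in>UNIV. c i * c i) = 0" by simp
    then have "\<forall>i. c i = 0" by (simp add: sum_nonneg_eq_0_iff)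
    with ac \<open>a = 0\<close> show False by blast
  qed
  with eq[of v] v show ?thesis by simp
qed

text \<open>Along a subsequence the kernels converge to some \<open>T\<close> containing
  \<open>v\<close>, so the projections of \<open>v\<close> onto the kernels tend to
  \<open>v\<close>. Each of them is orthogonal to the corresponding \<open>s n\<close>, and the
  inner product is continuous.\<close>

lemma thom_condition_orthogonal:
  fixes G :: "real^'m \<Rightarrow> real^'p"
  assumes thom: "thom_condition G X W" and x: "x \<in> W" "\<And>n. s n \<in> X" "s \<longlonglongrightarrow> x"
    and lin: "\<And>n. linear (frechet_derivative G (at (s n)))"
    and orth: "\<And>n v. frechet_derivative G (at (s n)) v = 0 \<Longrightarrow> s n \<bullet> v = 0"
    and v: "v \<in> tangent_space W x"
  shows "x \<bullet> v = 0"
proof -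
  let ?K = "\<lambda>n. {v. frechet_derivative G (at (s n)) v = 0}"
  have sub: "subspace (?K n)" for n
    using lin by (rule linear_subspace_kernel)
  obtain T r where r: "strict_mono r" and T: "grassmann_tendsto (?K \<circ> r) T"
    using grassmann_compact[of ?K] sub by blast
  have lim: "(\<lambda>n. s (r n)) \<longlonglongrightarrow> x"
    using LIMSEQ_subseq_LIMSEQ[OF x(3) r] by (simp add: comp_def)
  have "tangent_space W x \<subseteq> T"
    using thom[unfolded thom_condition_def, rule_format, of x "\<lambda>n. s (r n)" T] x lim T
    by (simp add: comp_def)
  then have "v = closest_point T v" using v by (auto simp: closest_point_self)
  moreover have "(\<lambda>n. closest_point (?K (r n)) v) \<longlonglongrightarrow> closest_point T v"
    using T by (simp add: grassmann_tendsto_def)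
  ultimately have "(\<lambda>n. s (r n) \<bullet> closest_point (?K (r n)) v) \<longlonglongrightarrow> x \<bullet> v"
    using lim by (intro tendsto_inner) simp_all
  moreover have "s (r n) \<bullet> closest_point (?K (r n)) v = 0" for n
    using orth closest_point_subspace_in[OF sub] by blast
  ultimately show ?thesis
    by (simp add: LIMSEQ_const_iff)
qed


section \<open>Differentiability of real analytic maps\<close>

text \<open>Each coordinate of \<open>h\<close> is at most \<open>q * t\<close> in absolute value
  with \<open>q = norm h / t\<close>. A monomial of degree \<open>n\<close> therefore gains the
  factor \<open>q ^ n\<close>, and \<open>q \<le> 1\<close> allows lowering the exponent to
  2.\<close>

lemma monomial_le:
  fixes h :: "real^'m"
  assumes h: "norm h \<le> t" "t > 0" and \<alpha>: "2 \<le> (\<Sum>j\<in>UNIV. \<alpha> j)"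
  shows "\<bar>\<Prod>j\<in>UNIV. (h $ j) ^ \<alpha> j\<bar> \<le> (norm h / t)\<^sup>2 * (\<Prod>j\<in>(UNIV :: 'm set). t ^ \<alpha> j)"
proof -
  let ?q = "norm h / t" and ?n = "\<Sum>j\<in>UNIV. \<alpha> j"
  have q: "0 \<le> ?q" "?q \<le> 1" using h by auto
  have "\<bar>\<Prod>j\<in>UNIV. (h $ j) ^ \<alpha> j\<bar> = (\<Prod>j\<in>UNIV. \<bar>h $ j\<bar> ^ \<alpha> j)"
    by (simp add: abs_prod power_abs)
  also have "\<dots> \<le> (\<Prod>j\<in>UNIV. norm h ^ \<alpha> j)"
    by (intro prod_mono) (auto intro: power_mono component_le_norm_cart)
  also have "\<dots> = (\<Prod>j\<in>UNIV. (?q * t) ^ \<alpha> j)" using h(2) by simp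
  also have "\<dots> = ?q ^ ?n * (\<Prod>j\<in>UNIV. t ^ \<alpha> j)"
    by (simp add: power_mult_distrib prod.distrib power_sum del: times_divide_eq_left)
  also have "\<dots> \<le> ?q\<^sup>2 * (\<Prod>j\<in>UNIV. t ^ \<alpha> j)"
    using q \<alpha> h(2) by (intro mult_right_mono power_decreasing prod_nonneg) auto
  finally show ?thesis .
qed

text \<open>The exponents of degree one; their coefficients in a power series are the partial
  derivatives at its centre.\<close>

definition unit_index :: "'m \<Rightarrow> 'm \<Rightarrow> nat" where
  "unit_index k = (\<lambda>j. if j = k then 1 else 0)"

lemma unit_index_eq_iff: "unit_index k = unit_index l \<longleftrightarrow> k = l"
  by (auto simp: unit_index_def fun_eq_iff split: if_splits)

lemma monomial_unit_index:
  "(\<Prod>j\<in>UNIV. (h $ j :: real) ^ unit_index k j) = h $ (k :: 'm::finite)"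
proof -
  have "(\<Prod>j\<in>UNIV. (h $ j) ^ unit_index k j) = (\<Prod>j\<in>UNIV. if j = k then h $ j else 1)"
    by (intro prod.cong) (auto simp: unit_index_def)
  then show ?thesis by simp
qed

lemma multi_index_degree_ge_2:
  fixes \<alpha> :: "'m::finite \<Rightarrow> nat"
  assumes "\<alpha> \<noteq> (\<lambda>_. 0)" "\<alpha> \<notin> range unit_index"
  shows "2 \<le> (\<Sum>j\<in>UNIV. \<alpha> j)"
proof -
  obtain k where k: "\<alpha> k \<noteq> 0" using assms(1) by auto
  have sum: "(\<Sum>j\<in>UNIV. \<alpha> j) = \<alpha> k + (\<Sum>j\<in>UNIV - {k}. \<alpha> j)" by (simp add: sum.remove)
  show ?thesis
  proof (cases "\<alpha> k = 1")
    case True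
    have "\<alpha> \<noteq> unit_index k" using assms(2) by blast
    with True obtain l where "l \<noteq> k" "\<alpha> l \<noteq> 0"
      by (auto simp: unit_index_def fun_eq_iff split: if_splits)
    then have "0 < (\<Sum>j\<in>UNIV - {k}. \<alpha> j)"
      by (intro sum_pos2[of _ l]) auto
    with True sum show ?thesis by linarith
  next
    case False
    with k have "2 \<le> \<alpha> k" by linarith
    with sum show ?thesis by linarith
  qed
qed

text \<open>Differentiability at \<open>a\<close> only needs the expansion centred at \<open>a\<close>: its terms of degree at
  least 2 are dominated by \<open>(s / t)\<^sup>2\<close> times the absolute values of the terms at the point
  \<open>a + (t, \<dots>, t)\<close>, where \<open>s\<close> is the norm of the increment.\<close>

lemma power_series_has_derivative:
  fixes f :: "real^'m \<Rightarrow> real" and c :: "('m \<Rightarrow> nat) \<Rightarrow> real"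
  assumes "r > 0"
    and f: "\<And>x. x \<in> ball a r \<Longrightarrow>
      ((\<lambda>\<alpha>. c \<alpha> * (\<Prod>j\<in>UNIV. (x $ j - a $ j) ^ \<alpha> j)) has_sum f x) UNIV"
  shows "(f has_derivative (\<lambda>h. \<Sum>k\<in>UNIV. c (unit_index k) * h $ k)) (at a)"
proof -
  define mon where "mon = (\<lambda>(h :: real^'m) \<alpha>. c \<alpha> * (\<Prod>j\<in>UNIV. (h $ j) ^ \<alpha> j))"
  have expansion: "(mon h has_sum f (a + h)) UNIV" if "norm h < r" for h
    using f[of "a + h"] that by (simp add: dist_norm mon_def)
  \<comment> \<open>The exponents of degree at most 1, whose terms form the affine part of the
    series; the rest is the remainder to be estimated.\<close>
  define low where "low = insert (\<lambda>_. 0) (range (unit_index :: 'm \<Rightarrow> _))"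
  have low: "finite low" by (simp add: low_def)
  let ?D = "\<lambda>h. \<Sum>k\<in>UNIV. c (unit_index k) * h $ k"
  have notin: "(\<lambda>_. 0) \<notin> range (unit_index :: 'm \<Rightarrow> _)"
  proof
    assume "(\<lambda>_. 0) \<in> range (unit_index :: 'm \<Rightarrow> _)"
    then obtain k :: 'm where "(\<lambda>_. 0) = unit_index k" by blast
    from fun_cong[OF this, of k] show False by (simp add: unit_index_def)
  qed
  have sum_low: "sum (mon h) low = c (\<lambda>_. 0) + ?D h" for h
  proof -
    have "sum (mon h) low = mon h (\<lambda>_. 0) + sum (mon h) (range unit_index)"
      unfolding low_def using notin by (subst sum.insert) auto
    also have "sum (mon h) (range unit_index) = (\<Sum>k\<in>UNIV. mon h (unit_index k))"
      by (subst sum.reindex) (auto simp: inj_def unit_index_eq_iff)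
    finally show ?thesis by (simp add: mon_def monomial_unit_index)
  qed
  have fa: "f a = c (\<lambda>_. 0)"
  proof -
    have "(mon 0 has_sum sum (mon 0) low) UNIV"
    proof (rule has_sum_finite_neutralI[OF low _ _ refl])
      fix \<alpha> :: "'m \<Rightarrow> nat" assume "\<alpha> \<in> UNIV - low"
      then have "\<exists>j. \<alpha> j \<noteq> 0" by (auto simp: low_def)
      then show "mon 0 \<alpha> = 0" by (auto simp: mon_def)
    qed simp
    then have "sum (mon 0) low = f a"
      using expansion[of 0] \<open>r > 0\<close> has_sum_unique by fastforce
    then show ?thesis by (simp add: sum_low)
  qed
  have rest: "(mon h has_sum (f (a + h) - f a - ?D h)) (- low)" if "norm h < r" for h
    using has_sum_Diff[OF expansion[OF that] has_sum_finite[OF low] subset_UNIV]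
    by (simp add: sum_low fa Compl_eq_Diff_UNIV diff_diff_eq)
  \<comment> \<open>Here \<open>1\<close> is the vector with all coordinates 1, so the comparison
    point \<open>(t, ..., t)\<close> has norm \<open>r / 2\<close> and lies inside the ball of
    convergence.\<close>
  define t where "t = r / (2 * norm (1 :: real^'m))"
  have one: "norm (1 :: real^'m) > 0" by simp
  have t: "t > 0" using \<open>r > 0\<close> one by (simp add: t_def)
  let ?t = "t *\<^sub>R (1 :: real^'m)"
  have "norm ?t = r / 2" using one \<open>r > 0\<close> by (simp add: t_def)
  then have "mon ?t summable_on - low"
    using rest[of ?t] \<open>r > 0\<close> has_sum_imp_summable by auto
  then have "(\<lambda>\<alpha>. norm (mon ?t \<alpha>)) summable_on - low"
    using summable_on_iff_abs_summable_on_real by blast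
  then obtain K where K: "((\<lambda>\<alpha>. norm (mon ?t \<alpha>)) has_sum K) (- low)"
    unfolding summable_on_def by blast
  have bound: "norm (f (a + h) - f a - ?D h) \<le> K * (norm h / t)\<^sup>2" if h: "norm h < r" "norm h \<le> t" for h
  proof -
    have "\<bar>mon h \<alpha>\<bar> \<le> norm (mon ?t \<alpha>) * (norm h / t)\<^sup>2" if "\<alpha> \<in> - low" for \<alpha>
    proof -
      have "2 \<le> (\<Sum>j\<in>UNIV. \<alpha> j)"
        using that by (intro multi_index_degree_ge_2) (auto simp: low_def)
      then have "\<bar>c \<alpha>\<bar> * \<bar>\<Prod>j\<in>UNIV. (h $ j) ^ \<alpha> j\<bar>
          \<le> \<bar>c \<alpha>\<bar> * ((norm h / t)\<^sup>2 * (\<Prod>j\<in>(UNIV :: 'm set). t ^ \<alpha> j))"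
        using h t by (intro mult_left_mono monomial_le) auto
      then show ?thesis
        using t by (simp add: mon_def abs_mult abs_prod mult_ac)
    qed
    moreover have "((\<lambda>\<alpha>. norm (mon ?t \<alpha>) * (norm h / t)\<^sup>2) has_sum K * (norm h / t)\<^sup>2) (- low)"
      using K by (rule has_sum_cmult_left)
    ultimately show ?thesis
      using norm_infsum_le[OF rest[OF h(1)]] by (simp add: mult.commute)
  qed
  show ?thesis
    unfolding has_derivative_at_alt
  proof (intro conjI allI impI)
    show "bounded_linear ?D"
      unfolding linear_conv_bounded_linear[symmetric]
      by (rule linearI) (auto simp: algebra_simps sum.distrib sum_distrib_left)
    fix e :: real assume "e > 0"
    have K0: "K \<ge> 0" using K by (rule has_sum_nonneg) simp
    \<comment> \<open>The inner minimum makes \<open>bound\<close> applicable; the last term gives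
      \<open>K * norm h / t\<^sup>2 \<le> e\<close>. Using \<open>K + 1\<close> avoids a division by
      zero when \<open>K = 0\<close>.\<close>
    define d where "d = min (min r t) (e * t\<^sup>2 / (K + 1))"
    have "d > 0" using \<open>r > 0\<close> t \<open>e > 0\<close> K0 by (simp add: d_def)
    moreover have "norm (f y - f a - ?D (y - a)) \<le> e * norm (y - a)" if "norm (y - a) < d" for y
    proof -
      let ?h = "y - a"
      have *: "norm ?h < r" "norm ?h \<le> t" "norm ?h \<le> e * t\<^sup>2 / (K + 1)"
        using that by (auto simp: d_def)
      have "norm ?h * (K + 1) \<le> e * t\<^sup>2"
        using *(3) K0 by (simp add: field_simps)
      then have "norm ?h * K / t\<^sup>2 \<le> e"
        using t by (simp add: divide_le_eq algebra_simps) (smt (verit) norm_ge_zero)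
      then have "norm ?h * K / t\<^sup>2 * norm ?h \<le> e * norm ?h"
        by (intro mult_right_mono) auto
      moreover have "K * (norm ?h / t)\<^sup>2 = norm ?h * K / t\<^sup>2 * norm ?h"
        by (simp add: power2_eq_square)
      ultimately show ?thesis using bound[OF *(1,2)] by simp
    qed
    ultimately show "\<exists>d>0. \<forall>y. norm (y - a) < d \<longrightarrow> norm (f y - f a - ?D (y - a)) \<le> e * norm (y - a)"
      by blast
  qed
qed

lemma real_analytic_on_differentiable:
  fixes G :: "real^'m \<Rightarrow> real^'p"
  assumes "real_analytic_on G U" "a \<in> U"
  shows "G differentiable (at a)"
proof -
  have "\<exists>D. ((\<lambda>x. G x $ i) has_derivative D) (at a)" for i
  proof -
    obtain r c where "r > 0" and c: "\<forall>x\<in>ball a r.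
        ((\<lambda>\<alpha>. c \<alpha> * (\<Prod>j\<in>UNIV. (x $ j - a $ j) ^ \<alpha> j)) has_sum G x $ i) UNIV"
      using assms unfolding real_analytic_on_def by blast
    show ?thesis
      by (rule exI, rule power_series_has_derivative[OF \<open>r > 0\<close> bspec[OF c]])
  qed
  then obtain D where "\<And>i. ((\<lambda>x. G x $ i) has_derivative D i) (at a)" by metis
  then have "(G has_derivative (\<lambda>h. \<chi> i. D i h)) (at a)"
    by (subst has_derivative_componentwise_within) (auto simp: Basis_vec_def inner_axis)
  then show ?thesis unfolding differentiable_def by blast
qed


section \<open>Thom regularity implies the Milnor condition\<close>

theorem proposition6p22:
  fixes G :: "real^'m \<Rightarrow> real^'p" and U :: "(real^'m) set"
  assumes "2 \<le> CARD('p)" and "CARD('p) \<le> CARD('m)"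
    and "open U" and "0 \<in> U" and "G 0 = 0"
    and "real_analytic_on G U"
    and "nonconstant_germ G"
    and "disc_germ_is_origin U G"
    and "thom_regular U G"
  shows "milnor_condition_b U G"
proof -
  let ?V = "zero_locus U G" and ?M = "milnor_set U G"
  have diff: "G differentiable (at x)" if "x \<in> U" for x
    using assms(6) that by (rule real_analytic_on_differentiable)
  obtain \<epsilon> \<W> where \<epsilon>: "\<epsilon> > 0" "ball 0 \<epsilon> \<subseteq> U"
    and strat: "stratification (?V \<inter> ball 0 \<epsilon>) \<W>"
    and whitney: "whitney_stratification (ball 0 \<epsilon>) (insert (ball 0 \<epsilon> - ?V) \<W>)"
    and thom: "\<And>W. W \<in> \<W> \<Longrightarrow> thom_condition G (ball 0 \<epsilon> - ?V) W"
    using assms(9) unfolding thom_regular_def by blast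
  have W: "smooth_submanifold W" if "W \<in> \<W>" for W
    using strat that unfolding stratification_def by blast
  have cover: "\<Union>\<W> = ?V \<inter> ball 0 \<epsilon>"
    using strat unfolding stratification_def by (blast dest: partition_onD1)
  have origin: "0 \<in> ?V \<inter> ball 0 \<epsilon>"
    using assms(4,5) \<epsilon>(1) by (simp add: zero_locus_def)
  then obtain W0 where W0: "W0 \<in> \<W>" "0 \<in> W0"
    using cover by blast
  \<comment> \<open>Local finiteness at the origin: only finitely many strata meet \<open>N\<close>,
    so their transversality neighbourhoods can be intersected.\<close>
  obtain N where N: "open N" "0 \<in> N" "finite {W\<in>\<W>. W \<inter> N \<noteq> {}}"
    using strat origin unfolding stratification_def by blast

  have "\<forall>\<^sub>F y in at 0. y \<in> W \<longrightarrow> (\<exists>v\<in>tangent_space W y. v \<bullet> (y - 0) \<noteq> 0)" if "W \<in> \<W>" for W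
  proof (cases "W = W0")
    case True
    then show ?thesis
      using submanifold_transverse_to_spheres[OF W[OF W0(1)] W0(2)] by simp
  next
    case False
    then have "whitney_b W W0"
      using whitney that W0(1) unfolding whitney_stratification_def by blast
    then show ?thesis
      using whitney_b_transverse_to_spheres[OF W[OF that] _ W0(2)] by simp
  qed
  then have transverse: "\<forall>\<^sub>F y in at 0. \<forall>W\<in>{W\<in>\<W>. W \<inter> N \<noteq> {}}.
      y \<in> W \<longrightarrow> (\<exists>v\<in>tangent_space W y. v \<bullet> y \<noteq> 0)"
    using N(3) by (intro eventually_ball_finite) simp_all

  \<comment> \<open>Fixing one radius, the equality of germs in the target is pulled back by
    continuity of \<open>G\<close>: singular points close to 0 have critical values close to 0,
    hence equal to 0.\<close>
  have "\<exists>\<epsilon>1. germ_eq (disc (U \<inter> ball 0 \<epsilon>1) G) {0} \<and> \<epsilon>1 > 0"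
    using assms(8) eventually_at_right_less unfolding disc_germ_is_origin_def
    by (intro eventually_happens'[OF trivial_limit_at_right_real] eventually_conj)
  then obtain \<epsilon>1 where "\<epsilon>1 > 0" and "\<forall>\<^sub>F z in nhds 0. z \<in> disc (U \<inter> ball 0 \<epsilon>1) G \<longleftrightarrow> z \<in> {0}"
    unfolding germ_eq_def by blast
  moreover have "(G \<longlongrightarrow> 0) (nhds 0)"
    using differentiable_imp_continuous_within[OF diff[OF assms(4)]] assms(5)
      tendsto_at_iff_tendsto_nhds[of G 0] by (simp add: continuous_within)
  ultimately have "\<forall>\<^sub>F x in nhds 0. G x \<in> disc (U \<inter> ball 0 \<epsilon>1) G \<longleftrightarrow> G x \<in> {0}"
    by (auto simp: filterlim_iff)
  moreover have "\<forall>\<^sub>F x in nhds 0. x \<in> U \<inter> ball 0 \<epsilon>1"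
    using assms(3,4) \<open>\<epsilon>1 > 0\<close> by (intro eventually_nhds_in_open) auto
  ultimately have "\<forall>\<^sub>F x in nhds 0. x \<in> sing U G \<longrightarrow> x \<in> ?V"
    by eventually_elim (auto simp: disc_def sing_def zero_locus_def)
  then obtain R where R: "open R" "0 \<in> R" "\<And>x. x \<in> R \<Longrightarrow> x \<in> sing U G \<Longrightarrow> x \<in> ?V"
    unfolding eventually_nhds by blast

  have ortho: "x \<bullet> v = 0"
    if x: "x \<in> closure (?M - ?V)" "x \<in> R" "x \<in> ball 0 \<epsilon>" "x \<in> W" "W \<in> \<W>"
      and v: "v \<in> tangent_space W x" for x v W
  proof -
    \<comment> \<open>Intersecting with an open neighbourhood of \<open>x\<close> keeps the
      approximating points in \<open>R\<close>, where points outside \<open>?V\<close> are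
      regular.\<close>
    have "open (R \<inter> ball 0 \<epsilon>)" using R(1) by blast
    then have "x \<in> closure ((R \<inter> ball 0 \<epsilon>) \<inter> (?M - ?V))"
      using x(1-3) open_Int_closure_subset by blast
    then obtain s where s: "\<And>n. s n \<in> (R \<inter> ball 0 \<epsilon>) \<inter> (?M - ?V)" "s \<longlonglongrightarrow> x"
      unfolding closure_sequential by blast
    have sU: "s n \<in> U" for n using s(1) \<epsilon>(2) by blast
    show ?thesis
    proof (rule thom_condition_orthogonal[OF thom[OF x(5)] x(4) _ s(2) _ _ v])
      show "s n \<in> ball 0 \<epsilon> - ?V" for n using s(1) by blast
      show "linear (frechet_derivative G (at (s n)))" for n
        using diff[OF sU] by (rule linear_frechet_derivative)
      show "s n \<bullet> w = 0" if "frechet_derivative G (at (s n)) w = 0" for n w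
        using diff[OF sU] assms(2) _ _ that
        by (rule milnor_set_orthogonal_kernel) (use s(1) R(3) in blast)+
    qed
  qed

  have "\<forall>\<^sub>F x in nhds 0. x \<in> N \<inter> R \<inter> ball 0 \<epsilon>"
    using N R \<epsilon>(1) by (intro eventually_nhds_in_open) auto
  with transverse show ?thesis
    unfolding milnor_condition_b_def germ_subset_def eventually_at_filter
  proof eventually_elim
    case (elim x)
    show ?case
    proof (intro impI, rule ccontr)
      assume x: "x \<in> closure (?M - ?V) \<inter> ?V" and "x \<notin> {0}"
      \<comment> \<open>Because \<open>x\<close> lies in \<open>N\<close>, this stratum is among the
        finitely many covered by \<open>transverse\<close>.\<close>
      then obtain W where "W \<in> \<W>" "x \<in> W" using cover elim(2) by blast
      with elim \<open>x \<notin> {0}\<close> obtain v where "v \<in> tangent_space W x" "v \<bullet> x \<noteq> 0" by blast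
      with ortho[of x W v] x elim(2) \<open>W \<in> \<W>\<close> \<open>x \<in> W\<close> show False
        by (simp add: inner_commute)
    qed
  qed
qed

end
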